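(* Let $w\in\mathbb R^n_{++}$, $b\in\mathbb R^n$, $c\in\mathbb R$ satisfy $c<\sum_{i=1}^n w_i b_i$, and let $D=\sum_{i=1}^n w_i b_i-c$. Define $w_{\min}=\min_i w_i$, $w_{\max}=\max_i w_i$, $b_{\min}=\min_i b_i$, $b_{\max}=\max_i b_i$, and $$\kappa=\left\lfloor\frac{w_{\max}}{w_{\min}}\right\rfloor+1,\qquad \eta=\frac1{w_{\max}}-\frac1{\kappa w_{\min}}>0 .$$ Let $\mathcal S\subseteq\{1,\dots,n\}$ be the active set and $\tau$ its associated threshold, and let $\rho_i=b_i-D/w_i$. (1) If $|\mathcal S|\ge\kappa$ and $b_{\max}-b_{\min}<D\eta$, then no $i\notin\mathcal S$ can satisfy the reset condition $\rho_i\ge\tau$. (2) Furthermore, if $b\in\mathbb R^n_{++}$ and $c=\gamma\sum_{i=1}^n w_i b_i$ for some $\gamma\in(0,1)$, then the same conclusion (no $i\notin\mathcal S$ satisfies $\rho_i\ge\tau$) holds whenever $|\mathcal S|\ge\kappa$ and $$n>N_0,\qquad N_0=\left\lfloor\frac{b_{\max}-b_{\min}}{(1-\gamma)w_{\min}b_{\min}\eta}\right\rfloor .$$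
   Context: $\mathbb R^n_{++}$ denotes the set of vectors with strictly positive entries. The active set $\mathcal S$ (nonempty) and the threshold $\tau$ maintained by the algorithm under study satisfy the invariant $\sum_{j\in\mathcal S}w_j(b_j-\tau)=D$, i.e. $$\tau=\frac{\sum_{j\in\mathcal S}w_jb_j-D}{\sum_{j\in\mathcal S}w_j}.$$ This invariant is the only property of $(\mathcal S,\tau)$ used in the statement. *)

theory Defs
  imports "HOL-Analysis.Analysis"
begin

definition vmin :: "real ^ 'n \<Rightarrow> real" where
  "vmin v = Min (range (\<lambda>i. v $ i))"

definition vmax :: "real ^ 'n \<Rightarrow> real" where
  "vmax v = Max (range (\<lambda>i. v $ i))"

definition kappa :: "real ^ 'n \<Rightarrow> int" where
  "kappa w = \<lfloor>vmax w / vmin w\<rfloor> + 1"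

definition eta :: "real ^ 'n \<Rightarrow> real" where
  "eta w = 1 / vmax w - 1 / (of_int (kappa w) * vmin w)"

definition rho :: "real ^ 'n \<Rightarrow> real ^ 'n \<Rightarrow> real \<Rightarrow> 'n \<Rightarrow> real" where
  "rho w b D i = b $ i - D / w $ i"

text \<open>The index type \<open>'n\<close> plays the role of \<open>{1, \<dots>, n}\<close>, so \<open>n\<close> is \<open>CARD('n)\<close>.\<close>

definition N0 :: "real ^ 'n \<Rightarrow> real ^ 'n \<Rightarrow> real \<Rightarrow> int" where
  "N0 w b \<gamma> = \<lfloor>(vmax b - vmin b) / ((1 - \<gamma>) * vmin w * vmin b * eta w)\<rfloor>"

text \<open>An active set with its threshold, characterised by the invariant that determines
  \<open>\<tau>\<close> uniquely when \<open>S\<close> is nonempty and the weights are positive.\<close>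

definition active_threshold ::
  "real ^ 'n \<Rightarrow> real ^ 'n \<Rightarrow> real \<Rightarrow> 'n set \<Rightarrow> real \<Rightarrow> bool" where
  "active_threshold w b D S \<tau> \<longleftrightarrow>
     S \<noteq> {} \<and> (\<Sum>j\<in>S. w $ j * (b $ j - \<tau>)) = D"

end

theory Submission
  imports Defs
begin

text \<open>
  The invariant says that \<open>\<tau>\<close> is the weighted mean of \<open>b\<close> over \<open>S\<close> minus \<open>D / w(S)\<close>, and
  \<open>w(S) \<ge> \<kappa> w_min\<close> as soon as \<open>S\<close> has \<open>\<kappa>\<close> elements, so \<open>\<tau> \<ge> b_min - D / (\<kappa> w_min)\<close>.
  On the other hand \<open>\<rho>_i \<le> b_max - D / w_max\<close> for every \<open>i\<close>. Subtracting gives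
  \<open>\<rho>_i - \<tau> \<le> (b_max - b_min) - D \<eta>\<close>. In the second part \<open>D = (1 - \<gamma>) \<Sum> w_i b_i\<close> is at least
  \<open>(1 - \<gamma>) n w_min b_min\<close>, so the condition on \<open>n\<close> again makes this bound negative.
\<close>

lemma vmin_le: "vmin v \<le> v $ i"
  unfolding vmin_def by (rule Min_le) auto

lemma vmax_ge: "v $ i \<le> vmax v"
  unfolding vmax_def by (rule Max_ge) auto

lemma vmin_pos:
  assumes "\<forall>i. v $ i > 0"
  shows "vmin v > 0"
  unfolding vmin_def using assms by (subst Min_gr_iff) auto

lemma vmin_le_vmax: "vmin v \<le> vmax v"
  using vmin_le vmax_ge order_trans by blast

text \<open>The floor plus one strictly exceeds the ratio. This strictness is what makes
  \<open>eta w\<close> positive.\<close>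

lemma kappa_vmin_gt_vmax:
  assumes "\<forall>i. w $ i > 0"
  shows "vmax w < of_int (kappa w) * vmin w"
proof -
  have "vmax w / vmin w < of_int (kappa w)"
    unfolding kappa_def by linarith
  then show ?thesis
    using vmin_pos[OF assms] by (simp add: pos_divide_less_eq)
qed

lemma eta_pos:
  assumes "\<forall>i. w $ i > 0"
  shows "eta w > 0"
proof -
  have "0 < vmax w"
    using vmin_pos[OF assms] vmin_le_vmax[of w] by linarith
  then show ?thesis
    unfolding eta_def using kappa_vmin_gt_vmax[OF assms]
    by (simp add: frac_less2)
qed

lemma threshold_ge:
  assumes w_pos: "\<forall>i. w $ i > 0" and D_nonneg: "0 \<le> D"
    and active: "active_threshold w b D S \<tau>"
    and card: "kappa w \<le> int (card S)"
  shows "vmin b - D / (of_int (kappa w) * vmin w) \<le> \<tau>"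
proof -
  define W where "W = (\<Sum>j\<in>S. w $ j)"
  have "of_int (kappa w) * vmin w \<le> real (card S) * vmin w"
    using card vmin_pos[OF w_pos] by (intro mult_right_mono) linarith+
  also have "\<dots> \<le> W"
    unfolding W_def by (rule sum_bounded_below) (rule vmin_le)
  finally have W_ge: "of_int (kappa w) * vmin w \<le> W" .
  have kw_pos: "0 < of_int (kappa w) * vmin w"
    using kappa_vmin_gt_vmax[OF w_pos] vmin_pos[OF w_pos] vmin_le_vmax[of w] by linarith
  \<comment> \<open>Lowering every \<open>b $ j\<close> in the invariant to \<open>vmin b\<close>
    can only decrease the weighted sum, as the weights are positive.\<close>
  have "W * (vmin b - \<tau>) = (\<Sum>j\<in>S. w $ j * (vmin b - \<tau>))"
    unfolding W_def by (rule sum_distrib_right)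
  also have "\<dots> \<le> (\<Sum>j\<in>S. w $ j * (b $ j - \<tau>))"
    using w_pos by (intro sum_mono mult_left_mono) (auto simp: vmin_le less_imp_le)
  also have "\<dots> = D"
    using active unfolding active_threshold_def by simp
  finally have "vmin b - \<tau> \<le> D / W"
    using W_ge kw_pos by (simp add: pos_le_divide_eq mult.commute)
  \<comment> \<open>As \<open>D\<close> is nonnegative, shrinking the positive denominator can only
    enlarge the quotient.\<close>
  also have "\<dots> \<le> D / (of_int (kappa w) * vmin w)"
    using W_ge kw_pos D_nonneg by (intro divide_left_mono) auto
  finally show ?thesis by linarith
qed

text \<open>With \<open>D\<close> nonnegative, the penalty \<open>D / w $ i\<close> is smallest at
  the largest weight. The maxima of \<open>b\<close> and \<open>w\<close> may sit at different
  indices, so the bound need not be attained.\<close>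

lemma rho_le:
  assumes w_pos: "\<forall>i. w $ i > 0" and D_nonneg: "0 \<le> D"
  shows "rho w b D i \<le> vmax b - D / vmax w"
proof -
  have "0 < w $ i" using w_pos by blast
  then have "D / vmax w \<le> D / w $ i"
    using vmax_ge[of w i] D_nonneg by (intro divide_left_mono) auto
  then show ?thesis
    unfolding rho_def using vmax_ge[of b i] by linarith
qed

lemma rho_less_threshold:
  assumes w_pos: "\<forall>i. w $ i > 0" and D_nonneg: "0 \<le> D"
    and active: "active_threshold w b D S \<tau>"
    and card: "kappa w \<le> int (card S)"
    and gap: "vmax b - vmin b < D * eta w"
  shows "rho w b D i < \<tau>"
proof -
  have "D * eta w = D / vmax w - D / (of_int (kappa w) * vmin w)"
    unfolding eta_def by (simp add: right_diff_distrib)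
  then show ?thesis
    using threshold_ge[OF w_pos D_nonneg active card] rho_le[OF w_pos D_nonneg, of b i] gap
    by linarith
qed

text \<open>Turns the condition on the dimension into the gap condition of
  \<open>rho_less_threshold\<close>, with \<open>D\<close> written out for
  \<open>c = \<gamma> * (\<Sum>i\<in>UNIV. w $ i * b $ i)\<close>.\<close>

lemma gap_less_if_card_gt_N0:
  fixes w b :: "real ^ 'n"
  assumes w_pos: "\<forall>i. w $ i > 0" and b_pos: "\<forall>i. b $ i > 0" and \<gamma>: "\<gamma> < 1"
    and card: "int CARD('n) > N0 w b \<gamma>"
  shows "vmax b - vmin b < (1 - \<gamma>) * (\<Sum>i\<in>UNIV. w $ i * b $ i) * eta w"
proof -
  define q where "q = (1 - \<gamma>) * vmin w * vmin b * eta w"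
  note pos = vmin_pos[OF w_pos] vmin_pos[OF b_pos] eta_pos[OF w_pos]
  have "q > 0"
    unfolding q_def using \<gamma> pos by simp
  \<comment> \<open>An integer exceeds the floor of a real exactly when it exceeds the real itself,
    so the rounding in \<open>N0\<close> loses nothing.\<close>
  moreover have "(vmax b - vmin b) / q < real CARD('n)"
    using card unfolding N0_def q_def by linarith
  ultimately have "vmax b - vmin b < real CARD('n) * q"
    by (simp add: pos_divide_less_eq)
  also have "\<dots> = (1 - \<gamma>) * (real CARD('n) * (vmin w * vmin b)) * eta w"
    unfolding q_def by simp
  also have "\<dots> \<le> (1 - \<gamma>) * (\<Sum>i\<in>UNIV. w $ i * b $ i) * eta w"
  proof -
    \<comment> \<open>Positivity of both vectors allows the two entrywise lower bounds to be
      multiplied in each term.\<close>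
    have "real CARD('n) * (vmin w * vmin b) \<le> (\<Sum>i\<in>UNIV. w $ i * b $ i)"
      using w_pos pos
      by (intro sum_bounded_below mult_mono) (auto simp: vmin_le less_imp_le)
    then show ?thesis
      using \<gamma> pos by (intro mult_right_mono mult_left_mono) auto
  qed
  finally show ?thesis .
qed

theorem theorem5:
  fixes w b :: "real ^ 'n" and c D \<tau> :: real and S :: "'n set"
  assumes w_pos: "\<forall>i. w $ i > 0"
    and c_less: "c < (\<Sum>i\<in>UNIV. w $ i * b $ i)"
    and D_eq: "D = (\<Sum>i\<in>UNIV. w $ i * b $ i) - c"
    and active: "active_threshold w b D S \<tau>"
  shows "eta w > 0 \<and>
    (int (card S) \<ge> kappa w \<and> vmax b - vmin b < D * eta w
       \<longrightarrow> \<not> (\<exists>i. i \<notin> S \<and> rho w b D i \<ge> \<tau>)) \<and>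
    (\<forall>\<gamma>. (\<forall>i. b $ i > 0) \<and> 0 < \<gamma> \<and> \<gamma> < 1 \<and> c = \<gamma> * (\<Sum>i\<in>UNIV. w $ i * b $ i)
         \<and> int (card S) \<ge> kappa w \<and> int CARD('n) > N0 w b \<gamma>
       \<longrightarrow> \<not> (\<exists>i. i \<notin> S \<and> rho w b D i \<ge> \<tau>))"
proof (intro conjI allI impI)
  show "eta w > 0" using w_pos by (rule eta_pos)
next
  have "0 \<le> D" using c_less D_eq by simp
  note below = rho_less_threshold[OF w_pos this active]
  {
    assume "int (card S) \<ge> kappa w \<and> vmax b - vmin b < D * eta w"
    then show "\<not> (\<exists>i. i \<notin> S \<and> rho w b D i \<ge> \<tau>)"
      using below by (meson not_le)
  next
    fix \<gamma>
    assume *: "(\<forall>i. b $ i > 0) \<and> 0 < \<gamma> \<and> \<gamma> < 1 \<and> c = \<gamma> * (\<Sum>i\<in>UNIV. w $ i * b $ i)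
      \<and> int (card S) \<ge> kappa w \<and> int CARD('n) > N0 w b \<gamma>"
    then have "D = (1 - \<gamma>) * (\<Sum>i\<in>UNIV. w $ i * b $ i)"
      using D_eq by (simp add: left_diff_distrib)
    then have "vmax b - vmin b < D * eta w"
      using gap_less_if_card_gt_N0[OF w_pos, of b \<gamma>] * by simp
    then show "\<not> (\<exists>i. i \<notin> S \<and> rho w b D i \<ge> \<tau>)"
      using below * by (meson not_le)
  }
qed

end
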